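(* Let $\hat U_1=(\hat u_1,\hat E_1)^T$ be a solution of the system $$\partial_t\begin{pmatrix}\hat u_1\\ \hat E_1\end{pmatrix}=-\hat A_1\begin{pmatrix}\hat u_1\\ \hat E_1\end{pmatrix},\qquad \hat A_1=\begin{pmatrix}1&1+\gamma k^2\\-1&0\end{pmatrix},$$ for all $t\ge0$, $k\in\mathbb{R}$, with initial data $(\hat u_{10},\hat E_{10})^T$ at $t=0$. Then $$\begin{pmatrix}\hat u_1(t,k)\\ \hat E_1(t,k)\end{pmatrix}=\hat G_f(t,k)\begin{pmatrix}\hat u_{10}\\ \hat E_{10}\end{pmatrix},$$ where $$\hat G_f=\begin{pmatrix}\dfrac{\lambda_+e^{\lambda_+t}-\lambda_-e^{\lambda_-t}}{\lambda_+-\lambda_-}&-(1+\gamma k^2)\dfrac{e^{\lambda_+t}-e^{\lambda_-t}}{\lambda_+-\lambda_-}\\[2mm] \dfrac{e^{\lambda_+t}-e^{\lambda_-t}}{\lambda_+-\lambda_-}&\dfrac{\lambda_+e^{\lambda_-t}-\lambda_-e^{\lambda_+t}}{\lambda_+-\lambda_-}\end{pmatrix}.$$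
   Context: $\gamma>0$ is a constant ($\gamma=P'(1)$ for the pressure $P$). $\lambda_\pm=\lambda_\pm(k)$ are the two roots of $\det(\lambda\mathbb{I}_2+\hat A_1)=\lambda^2+\lambda+1+\gamma k^2=0$, i.e. $\lambda_\pm=\frac{-1\pm i\sqrt{3+4\gamma k^2}}{2}$. The system is the Fourier transform in $x$ of the linear system $\partial_tu_1-\gamma\partial_{xx}E_1+E_1+u_1=0$, $\partial_tE_1-u_1=0$. *)

theory Defs
  imports "HOL-Analysis.Analysis"
begin

definition A1_hat :: "real \<Rightarrow> real \<Rightarrow> complex^2^2" where
  "A1_hat \<gamma> k =
     vector [vector [1, complex_of_real (1 + \<gamma> * k\<^sup>2)],
             vector [-1, 0]]"

definition lambda_plus :: "real \<Rightarrow> real \<Rightarrow> complex" where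
  "lambda_plus \<gamma> k = (-1 + \<i> * complex_of_real (sqrt (3 + 4 * \<gamma> * k\<^sup>2))) / 2"

definition lambda_minus :: "real \<Rightarrow> real \<Rightarrow> complex" where
  "lambda_minus \<gamma> k = (-1 - \<i> * complex_of_real (sqrt (3 + 4 * \<gamma> * k\<^sup>2))) / 2"

lemma det_A1_hat:
  "det (mat z + A1_hat \<gamma> k) = z\<^sup>2 + z + 1 + complex_of_real (\<gamma> * k\<^sup>2)"
  by (simp add: det_2 A1_hat_def mat_def vector_2 power2_eq_square algebra_simps)

lemma det_A1_hat_eq_0_iff:
  assumes "\<gamma> > 0"
  shows "det (mat z + A1_hat \<gamma> k) = 0 \<longleftrightarrow> z = lambda_plus \<gamma> k \<or> z = lambda_minus \<gamma> k"
proof -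
  define s where "s = complex_of_real (sqrt (3 + 4 * \<gamma> * k\<^sup>2))"
  have "(sqrt (3 + 4 * \<gamma> * k\<^sup>2))\<^sup>2 = 3 + 4 * \<gamma> * k\<^sup>2"
    using assms by (intro real_sqrt_pow2) auto
  then have s2: "s\<^sup>2 = complex_of_real (3 + 4 * \<gamma> * k\<^sup>2)"
    unfolding s_def by (metis of_real_power)
  have "(z - lambda_plus \<gamma> k) * (z - lambda_minus \<gamma> k) = z\<^sup>2 + z + (1 + s\<^sup>2) / 4"
    unfolding lambda_plus_def lambda_minus_def s_def[symmetric]
    by (simp add: field_simps power2_eq_square)
  also have "\<dots> = det (mat z + A1_hat \<gamma> k)"
    unfolding det_A1_hat s2 by (simp add: field_simps)
  finally show ?thesis
    by (metis (no_types) eq_iff_diff_eq_0 mult_eq_0_iff)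
qed

definition Gf_hat :: "real \<Rightarrow> real \<Rightarrow> real \<Rightarrow> complex^2^2" where
  "Gf_hat \<gamma> t k =
    (let lp = lambda_plus \<gamma> k; lm = lambda_minus \<gamma> k;
         ep = exp (lp * complex_of_real t); em = exp (lm * complex_of_real t)
     in vector
       [vector [(lp * ep - lm * em) / (lp - lm),
                - complex_of_real (1 + \<gamma> * k\<^sup>2) * ((ep - em) / (lp - lm))],
        vector [(ep - em) / (lp - lm),
                (lp * em - lm * ep) / (lp - lm)]])"

end

theory Submission
  imports Defs
begin

text \<open>
  For fixed \<open>k\<close> the system reads \<open>E' = u\<close>, \<open>u' = - u - c E\<close> with \<open>c = 1 + \<gamma> k\<^sup>2\<close>, and Vieta's
  formulas \<open>\<lambda>\<^sub>+ + \<lambda>\<^sub>- = -1\<close>, \<open>\<lambda>\<^sub>+ \<lambda>\<^sub>- = c\<close> diagonalise it: the left eigenvectors of \<open>- A\<close> give the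
  combinations \<open>u - \<lambda>\<^sub>- E\<close> and \<open>u - \<lambda>\<^sub>+ E\<close>, which satisfy the decoupled scalar equations
  \<open>y' = \<lambda>\<^sub>+ y\<close> and \<open>y' = \<lambda>\<^sub>- y\<close>. A solution of \<open>y' = a y\<close> on the half-line is determined by its
  initial value, so both combinations are known exponentials. Since \<open>\<gamma> > 0\<close> makes
  \<open>\<lambda>\<^sub>+ \<noteq> \<lambda>\<^sub>-\<close>, solving the two linear equations for \<open>u\<close> and \<open>E\<close> yields the entries of the
  Green matrix.
\<close>

text \<open>Multiplying by the integrating factor \<open>exp (- a t)\<close> turns the equation into one with
  vanishing derivative on a convex set.\<close>

lemma linear_ode_unique_solution:
  fixes y :: "real \<Rightarrow> complex" and a :: complex
  assumes deriv: "\<And>s. s \<ge> 0 \<Longrightarrow> (y has_vector_derivative a * y s) (at s within {0..})"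
    and t: "t \<ge> 0"
  shows "y t = exp (a * complex_of_real t) * y 0"
proof -
  define g where "g = (\<lambda>s. exp (s *\<^sub>R (- a)) * y s)"
  have "(g has_vector_derivative 0) (at s within {0..})" if "s \<in> {0..}" for s
    unfolding g_def
    using has_vector_derivative_mult
      [OF exp_scaleR_has_vector_derivative_right[of "- a" s "{0..}"] deriv[of s]] that
    by (simp add: algebra_simps)
  then obtain c where "\<And>s. s \<in> {0..} \<Longrightarrow> g s = c"
    using has_vector_derivative_zero_constant[of "{0..}" g] by auto
  then have "g t = g 0"
    using t by simp
  then show ?thesis
    by (simp add: g_def exp_minus scaleR_conv_of_real field_simps)
qed

lemma lambda_sum: "lambda_plus \<gamma> k + lambda_minus \<gamma> k = -1"
  by (simp add: lambda_plus_def lambda_minus_def field_simps)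

lemma lambda_prod:
  assumes "\<gamma> > 0"
  shows "lambda_plus \<gamma> k * lambda_minus \<gamma> k = complex_of_real (1 + \<gamma> * k\<^sup>2)"
proof -
  define s where "s = complex_of_real (sqrt (3 + 4 * \<gamma> * k\<^sup>2))"
  have "(sqrt (3 + 4 * \<gamma> * k\<^sup>2))\<^sup>2 = 3 + 4 * \<gamma> * k\<^sup>2"
    using assms by (intro real_sqrt_pow2) auto
  then have s2: "s\<^sup>2 = complex_of_real (3 + 4 * \<gamma> * k\<^sup>2)"
    unfolding s_def by (metis of_real_power)
  have "lambda_plus \<gamma> k * lambda_minus \<gamma> k = (1 + s\<^sup>2) / 4"
    unfolding lambda_plus_def lambda_minus_def s_def[symmetric]
    by (simp add: field_simps power2_eq_square)
  also have "\<dots> = complex_of_real (1 + \<gamma> * k\<^sup>2)"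
    unfolding s2 by (simp add: field_simps)
  finally show ?thesis .
qed

lemma lambda_distinct:
  assumes "\<gamma> > 0"
  shows "lambda_plus \<gamma> k \<noteq> lambda_minus \<gamma> k"
proof -
  have "3 + 4 * \<gamma> * k\<^sup>2 > 0"
    using assms by (intro add_pos_nonneg) auto
  then show ?thesis
    unfolding lambda_plus_def lambda_minus_def
    by (simp add: complex_eq_iff)
qed

theorem proposition2p6:
  fixes \<gamma> :: real
    and u1 E1 :: "real \<Rightarrow> real \<Rightarrow> complex"
    and u10 E10 :: "real \<Rightarrow> complex"
  assumes "\<gamma> > 0"
    and "\<And>t k. t \<ge> 0 \<Longrightarrow>
      ((\<lambda>t. vector [u1 t k, E1 t k] :: complex^2) has_vector_derivative
        (- A1_hat \<gamma> k) *v vector [u1 t k, E1 t k]) (at t within {0..})"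
    and "\<And>k. u1 0 k = u10 k"
    and "\<And>k. E1 0 k = E10 k"
  shows "\<forall>t\<ge>0. \<forall>k.
    (vector [u1 t k, E1 t k] :: complex^2) = Gf_hat \<gamma> t k *v vector [u10 k, E10 k]"
proof (intro allI impI)
  fix t k :: real
  assume t: "t \<ge> 0"
  define c where "c = complex_of_real (1 + \<gamma> * k\<^sup>2)"
  define p where "p = lambda_plus \<gamma> k"
  define m where "m = lambda_minus \<gamma> k"
  have sum: "p + m = -1" and prod: "p * m = c" and dist: "p - m \<noteq> 0"
    using lambda_sum lambda_prod[OF assms(1)] lambda_distinct[OF assms(1)]
    by (simp_all add: p_def m_def c_def)
  have du: "((\<lambda>t. u1 t k) has_vector_derivative - u1 s k - c * E1 s k) (at s within {0..})"
    and dE: "((\<lambda>t. E1 t k) has_vector_derivative u1 s k) (at s within {0..})"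
    if "s \<ge> 0" for s
    using bounded_linear.has_vector_derivative[OF bounded_linear_vec_nth[of 1] assms(2)[OF that, of k]]
      bounded_linear.has_vector_derivative[OF bounded_linear_vec_nth[of 2] assms(2)[OF that, of k]]
    by (simp_all add: A1_hat_def matrix_vector_mult_def sum_2 vector_2 c_def)
  \<comment> \<open>Symmetric in the two roots, so one argument serves both eigendirections.\<close>
  have decoupled: "u1 t k - b * E1 t k = exp (a * complex_of_real t) * (u10 k - b * E10 k)"
    if "a + b = -1" "a * b = c" for a b
  proof -
    have "((\<lambda>t. u1 t k - b * E1 t k) has_vector_derivative a * (u1 s k - b * E1 s k))
        (at s within {0..})" if "s \<ge> 0" for s
    proof -
      have "- u1 s k - c * E1 s k - b * u1 s k = a * (u1 s k - b * E1 s k)"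
        using \<open>a + b = -1\<close> \<open>a * b = c\<close> by algebra
      then show ?thesis
        using has_vector_derivative_diff[OF du[OF that]
            has_vector_derivative_mult_right[OF dE[OF that], of b]] by simp
    qed
    from linear_ode_unique_solution[OF this t] show ?thesis
      by (simp add: assms(3,4))
  qed
  define ep where "ep = exp (p * complex_of_real t)"
  define em where "em = exp (m * complex_of_real t)"
  have plus: "u1 t k - m * E1 t k = ep * (u10 k - m * E10 k)"
    unfolding ep_def using sum prod by (rule decoupled)
  have minus: "u1 t k - p * E1 t k = em * (u10 k - p * E10 k)"
    unfolding em_def using sum prod by (intro decoupled) (simp_all add: ac_simps)
  have "(p - m) * E1 t k = (ep - em) * u10 k + (p * em - m * ep) * E10 k"
    using plus minus by algebra
  then have "E1 t k = ((ep - em) * u10 k + (p * em - m * ep) * E10 k) / (p - m)"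
    using dist by (simp add: eq_divide_eq mult.commute)
  then have E: "E1 t k = (ep - em) / (p - m) * u10 k + (p * em - m * ep) / (p - m) * E10 k"
    by (simp add: add_divide_distrib diff_divide_distrib algebra_simps)
  have "(p - m) * u1 t k = (p * ep - m * em) * u10 k - c * (ep - em) * E10 k"
    using plus minus prod by algebra
  then have "u1 t k = ((p * ep - m * em) * u10 k - c * (ep - em) * E10 k) / (p - m)"
    using dist by (simp add: eq_divide_eq mult.commute)
  then have u: "u1 t k = (p * ep - m * em) / (p - m) * u10 k + - c * ((ep - em) / (p - m)) * E10 k"
    by (simp add: add_divide_distrib diff_divide_distrib algebra_simps)
  have G: "Gf_hat \<gamma> t k = vector
      [vector [(p * ep - m * em) / (p - m), - c * ((ep - em) / (p - m))],
       vector [(ep - em) / (p - m), (p * em - m * ep) / (p - m)]]"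
    by (simp add: Gf_hat_def Let_def p_def m_def ep_def em_def c_def)
  show "(vector [u1 t k, E1 t k] :: complex^2) = Gf_hat \<gamma> t k *v vector [u10 k, E10 k]"
    unfolding G vec_eq_iff forall_2 matrix_vector_mult_def sum_2
    using u E by (simp add: vector_2 sum_2)
qed

end
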